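(* Let $X$ be a Banach space and $G \subseteq \mathcal{L}(X)$ be a compact group of isometries. If $C$ is a closed convex $G$-invariant subset of $X$ and $x_0$ is a $G$-invariant point such that $x_0 \notin C$, then there is $x^* \in X^*$ which is $G$-invariant such that $$\operatorname{Re} x^*(x_0) > \sup\{\operatorname{Re} x^*(x) : x\in C\}.$$
   Context: $X$ is a Banach space over $\mathbb{K}\in\{\mathbb{R},\mathbb{C}\}$, $X^*$ is its dual, and $\mathcal{L}(X)$ is the space of bounded linear operators on $X$. A group $G\subseteq\mathcal{L}(X)$ is a group (under composition) of invertible bounded linear maps on $X$ endowed with the relative (operator norm) topology of $\mathcal{L}(X)$; "compact" refers to this topology. "Group of isometries" means that every $g\in G$ is an isometric isomorphism of $X$. A set $C\subseteq X$ is $G$-invariant if $g(C)\subseteq C$ for every $g\in G$; a point $x_0$ is $G$-invariant if $g(x_0)=x_0$ for all $g\in G$; a functional $x^*$ is $G$-invariant if $x^*(g(x))=x^*(x)$ for all $x\in X$, $g\in G$. *)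

theory Defs
  imports "HOL-Analysis.Analysis"
begin

(* The scalar field K, which is the real or the complex numbers: a normed field together with
   an isometric field embedding into the complex numbers whose image is one of the two. *)
class real_or_complex = real_normed_field +
  fixes to_complex :: "'a \<Rightarrow> complex"
  assumes to_complex_add: "to_complex (x + y) = to_complex x + to_complex y"
    and to_complex_mult: "to_complex (x * y) = to_complex x * to_complex y"
    and to_complex_scaleR: "to_complex (r *\<^sub>R x) = r *\<^sub>R to_complex x"
    and norm_to_complex: "cmod (to_complex x) = norm x"
    and range_to_complex: "range to_complex = \<real> \<or> range to_complex = UNIV"

instantiation real :: real_or_complex
begin
definition to_complex_real :: "real \<Rightarrow> complex" where "to_complex_real = complex_of_real"
instance
  by standard (auto simp: to_complex_real_def Reals_def scaleR_conv_of_real)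
end

instantiation complex :: real_or_complex
begin
definition to_complex_complex :: "complex \<Rightarrow> complex" where "to_complex_complex = (\<lambda>z. z)"
instance
  by standard (auto simp: to_complex_complex_def)
end

definition re_part :: "'k::real_or_complex \<Rightarrow> real"
  where "re_part c = Re (to_complex c)"

lemma re_part_real [simp]: "re_part (r::real) = r"
  by (simp add: re_part_def to_complex_real_def)

lemma re_part_complex [simp]: "re_part (z::complex) = Re z"
  by (simp add: re_part_def to_complex_complex_def)

(* A normed space over K. The class real_normed_vector carries the norm and the underlying
   real vector space; the K-scalar multiplication is a parameter extending the real one. *)
locale normed_space_over = vector_space smul
  for smul :: "'k::real_or_complex \<Rightarrow> 'a::real_normed_vector \<Rightarrow> 'a" +
  assumes smul_of_real: "smul (of_real r) x = r *\<^sub>R x"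
    and norm_smul: "norm (smul c x) = norm c * norm x"

lemma normed_space_over_real:
  "normed_space_over ((*\<^sub>R) :: real \<Rightarrow> 'a::real_normed_vector \<Rightarrow> 'a)"
  by unfold_locales (auto simp: algebra_simps)

lemma normed_space_over_complex: "normed_space_over ((*) :: complex \<Rightarrow> complex \<Rightarrow> complex)"
  by unfold_locales (auto simp: algebra_simps norm_mult scaleR_conv_of_real)

(* L(X): the library's bounded linear maps are only real-linear, so K-linearity is added.
   Their norm is the usual operator norm, and it induces the topology on L(X). *)
definition bounded_operators ::
    "('k::real_or_complex \<Rightarrow> 'a::real_normed_vector \<Rightarrow> 'a) \<Rightarrow> ('a \<Rightarrow>\<^sub>L 'a) set"
  where "bounded_operators smul = {T. Vector_Spaces.linear smul smul (blinfun_apply T)}"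

definition dual_space ::
    "('k::real_or_complex \<Rightarrow> 'a::real_normed_vector \<Rightarrow> 'a) \<Rightarrow> ('a \<Rightarrow>\<^sub>L 'k) set"
  where "dual_space smul = {f. Vector_Spaces.linear smul (*) (blinfun_apply f)}"

definition operator_group ::
    "('k::real_or_complex \<Rightarrow> 'a::real_normed_vector \<Rightarrow> 'a) \<Rightarrow> ('a \<Rightarrow>\<^sub>L 'a) set \<Rightarrow> bool"
  where "operator_group smul G \<longleftrightarrow>
    G \<subseteq> bounded_operators smul \<and>
    id_blinfun \<in> G \<and>
    (\<forall>g\<in>G. \<forall>h\<in>G. g o\<^sub>L h \<in> G) \<and>
    (\<forall>g\<in>G. \<exists>h\<in>G. g o\<^sub>L h = id_blinfun \<and> h o\<^sub>L g = id_blinfun)"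

(* Surjectivity need not be required: the members of an operator group are invertible. *)
definition group_of_isometries ::
    "('k::real_or_complex \<Rightarrow> 'a::real_normed_vector \<Rightarrow> 'a) \<Rightarrow> ('a \<Rightarrow>\<^sub>L 'a) set \<Rightarrow> bool"
  where "group_of_isometries smul G \<longleftrightarrow>
    operator_group smul G \<and> (\<forall>g\<in>G. \<forall>x. norm (blinfun_apply g x) = norm x)"

definition invariant_set :: "('a::real_normed_vector \<Rightarrow>\<^sub>L 'a) set \<Rightarrow> 'a set \<Rightarrow> bool"
  where "invariant_set G C \<longleftrightarrow> (\<forall>g\<in>G. blinfun_apply g ` C \<subseteq> C)"

definition invariant_point :: "('a::real_normed_vector \<Rightarrow>\<^sub>L 'a) set \<Rightarrow> 'a \<Rightarrow> bool"
  where "invariant_point G x \<longleftrightarrow> (\<forall>g\<in>G. blinfun_apply g x = x)"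

definition invariant_functional ::
    "('a::real_normed_vector \<Rightarrow>\<^sub>L 'a) set \<Rightarrow> ('a \<Rightarrow>\<^sub>L 'k::real_normed_vector) \<Rightarrow> bool"
  where "invariant_functional G f \<longleftrightarrow>
    (\<forall>g\<in>G. \<forall>x. blinfun_apply f (blinfun_apply g x) = blinfun_apply f x)"

end

theory Submission
  imports Defs
begin

text \<open>
  A closed convex set and a point outside it are strictly separated by some bounded functional
  \<open>f\<close>, by the Hahn--Banach theorem.  To make \<open>f\<close> invariant, one composes it with an average
  \<open>P\<close> of the group: an operator in the closed convex hull of \<open>G\<close> with \<open>P \<circ> g = P\<close> for all
  \<open>g \<in> G\<close>.  Then \<open>f \<circ> P\<close> is invariant; and since every closed convex condition that holds for
  all \<open>g \<in> G\<close> passes to \<open>P\<close>, the operator \<open>P\<close> is linear over the scalars, maps \<open>C\<close> into \<open>C\<close> and fixes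
  \<open>x\<^sub>0\<close>.  Hence \<open>f \<circ> P\<close> takes at \<open>x\<^sub>0\<close> the value \<open>f x\<^sub>0\<close>, and its values on \<open>C\<close> are
  among those of \<open>f\<close> on \<open>C\<close>, so it separates with the same gap.

  The operator \<open>P\<close> (lemma \<open>invariant_average_ex\<close>) would classically be the integral of \<open>g\<close> with
  respect to Haar measure.  Here it is built directly.  For \<open>A\<close> in the convex hull of \<open>G\<close>
  consider the diameter of the orbit \<open>{A \<circ> g | g \<in> G}\<close>.  Composing \<open>A\<close> with the mean of a
  finite net of \<open>G\<close>, which exists by compactness, shrinks this diameter by a factor depending only
  on the size of the net (\<open>average_over_net\<close>), as long as the diameter is at least twice the mesh; so
  arbitrarily small diameters occur.  If \<open>A\<close> has
  orbit diameter at most \<open>e\<close>, then \<open>A \<circ> B\<close> is within \<open>e\<close> of \<open>A\<close> for all \<open>B\<close> in the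
  hull; therefore products of hull elements of smaller and smaller orbit diameter form a Cauchy
  sequence, and its limit is the average.

  The Hahn--Banach part rests on one construction (\<open>sublinear_push_down\<close>), which lowers a sublinear
  functional in the directions opposite to a given convex set.  Applied to a single point it shows
  that minimal sublinear functionals are linear; applied to the norm and the set of all
  \<open>x\<^sub>0 - c\<close> with \<open>c \<in> C\<close> it yields the separation.  Real functionals are
  turned into functionals that are linear over the scalars by the usual formula \<open>u x - i u (i x)\<close>.
\<close>

section \<open>Sublinear functionals\<close>

text \<open>
  Positive homogeneity is required only as an inequality: applying it to \<open>t\<close> and to \<open>1 / t\<close>
  gives equality, and \<open>t = 2\<close> at the origin gives the value \<open>0\<close> there.
\<close>

definition sublinear :: "('a::real_vector \<Rightarrow> real) \<Rightarrow> bool"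
  where "sublinear q \<longleftrightarrow>
    (\<forall>x y. q (x + y) \<le> q x + q y) \<and> (\<forall>t>0. \<forall>x. q (t *\<^sub>R x) \<le> t * q x)"

lemma sublinear_add: "sublinear q \<Longrightarrow> q (x + y) \<le> q x + q y"
  by (simp add: sublinear_def)

lemma sublinear_scaleR_le: "sublinear q \<Longrightarrow> 0 < t \<Longrightarrow> q (t *\<^sub>R x) \<le> t * q x"
  by (simp add: sublinear_def)

lemma sublinear_scaleR:
  assumes "sublinear q" "0 < t"
  shows "q (t *\<^sub>R x) = t * q x"
proof (rule antisym)
  show "q (t *\<^sub>R x) \<le> t * q x"
    using assms by (rule sublinear_scaleR_le)
  have "q ((1/t) *\<^sub>R (t *\<^sub>R x)) \<le> (1/t) * q (t *\<^sub>R x)"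
    using assms by (intro sublinear_scaleR_le) auto
  then show "t * q x \<le> q (t *\<^sub>R x)"
    using assms(2) by (simp add: field_simps)
qed

lemma sublinear_zero:
  assumes "sublinear q"
  shows "q 0 = 0"
  using sublinear_scaleR[OF assms, of 2 0] by simp

lemma sublinear_minus:
  assumes "sublinear q"
  shows "- q (- x) \<le> q x"
  using sublinear_add[OF assms, of x "- x"] sublinear_zero[OF assms] by simp

lemma sublinear_norm: "sublinear (norm :: 'a::real_normed_vector \<Rightarrow> real)"
  by (simp add: sublinear_def norm_triangle_ineq)

text \<open>
  The two conditions on the family cover both infima taken below: over a cone, where the indices
  can be added, and over a chain, where the smaller of two members can be taken.
\<close>

lemma sublinear_INF:
  fixes h :: "'i \<Rightarrow> 'a::real_vector \<Rightarrow> real"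
  assumes "I \<noteq> {}"
    and bdd: "\<And>x. bdd_below ((\<lambda>i. h i x) ` I)"
    and add: "\<And>i j x y. i \<in> I \<Longrightarrow> j \<in> I \<Longrightarrow> \<exists>k\<in>I. h k (x + y) \<le> h i x + h j y"
    and scale: "\<And>i t x. i \<in> I \<Longrightarrow> 0 < t \<Longrightarrow> \<exists>k\<in>I. h k (t *\<^sub>R x) \<le> t * h i x"
  shows "sublinear (\<lambda>x. INF i\<in>I. h i x)"
proof -
  define p where "p x = (INF i\<in>I. h i x)" for x
  have lower: "p x \<le> h i x" if "i \<in> I" for i x
    unfolding p_def using bdd that by (rule cINF_lower)
  have greatest: "m \<le> p x" if "\<And>i. i \<in> I \<Longrightarrow> m \<le> h i x" for m x
    unfolding p_def using \<open>I \<noteq> {}\<close> that by (rule cINF_greatest)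
  have "p (x + y) \<le> p x + p y" for x y
  proof -
    have "p (x + y) - h i x \<le> p y" if "i \<in> I" for i
    proof (rule greatest)
      fix j assume "j \<in> I"
      then obtain k where "k \<in> I" "h k (x + y) \<le> h i x + h j y"
        using add \<open>i \<in> I\<close> by blast
      then show "p (x + y) - h i x \<le> h j y"
        using lower[of k "x + y"] by linarith
    qed
    then have "p (x + y) - p y \<le> p x"
      by (intro greatest) (simp add: algebra_simps)
    then show ?thesis by simp
  qed
  moreover have "p (t *\<^sub>R x) \<le> t * p x" if "0 < t" for t x
  proof -
    have "p (t *\<^sub>R x) / t \<le> p x"
    proof (rule greatest)
      fix i assume "i \<in> I"
      then obtain k where "k \<in> I" "h k (t *\<^sub>R x) \<le> t * h i x"
        using scale \<open>0 < t\<close> by blast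
      then show "p (t *\<^sub>R x) / t \<le> h i x"
        using lower[of k "t *\<^sub>R x"] that by (simp add: field_simps)
    qed
    then show ?thesis using that by (simp add: field_simps)
  qed
  ultimately show ?thesis
    unfolding sublinear_def p_def by blast
qed

text \<open>
  The functional is \<open>p x = inf {q (x + t c) - t b | t \<ge> 0, c \<in> D}\<close>.  The bound \<open>q \<ge> b\<close> on
  \<open>D\<close> is what keeps the infimum finite: \<open>t b \<le> q (t c) \<le> q (x + t c) + q (- x)\<close>.  The choice
  \<open>t = 0\<close> gives \<open>p \<le> q\<close>, and \<open>t = 1\<close> gives the bound at \<open>- c\<close>.
\<close>

lemma sublinear_push_down:
  fixes q :: "'a::real_vector \<Rightarrow> real"
  assumes q: "sublinear q" and D: "convex D" "D \<noteq> {}" and b: "\<And>c. c \<in> D \<Longrightarrow> b \<le> q c"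
  obtains p where "sublinear p" "\<And>x. p x \<le> q x" "\<And>c. c \<in> D \<Longrightarrow> p (- c) \<le> - b"
proof -
  define I where "I = {0::real..} \<times> D"
  define h where "h = (\<lambda>(t, c) x. q (x + t *\<^sub>R c) - t * b)"
  define p where "p x = (INF i\<in>I. h i x)" for x
  have ne: "I \<noteq> {}"
    using D by (auto simp: I_def)
  have bdd: "bdd_below ((\<lambda>i. h i x) ` I)" for x
  proof (rule bdd_belowI2)
    fix i assume "i \<in> I"
    then obtain t c where i: "i = (t, c)" "0 \<le> t" "c \<in> D"
      by (auto simp: I_def)
    have "t * b \<le> q (t *\<^sub>R c)"
      using i b[of c] sublinear_scaleR[OF q, of t c] sublinear_zero[OF q]
      by (cases "t = 0") (auto intro: mult_left_mono)
    also have "\<dots> \<le> q (x + t *\<^sub>R c) + q (- x)"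
      using sublinear_add[OF q, of "x + t *\<^sub>R c" "- x"] by simp
    finally show "- q (- x) \<le> h i x"
      by (simp add: h_def i)
  qed
  have "sublinear p"
    unfolding p_def
  proof (rule sublinear_INF[OF ne bdd])
    fix i j x y assume "i \<in> I" "j \<in> I"
    then obtain s c t d where ij: "i = (s, c)" "j = (t, d)" "0 \<le> s" "0 \<le> t" "c \<in> D" "d \<in> D"
      by (auto simp: I_def)
    \<comment> \<open>The cone over a convex set is closed under addition.\<close>
    have "\<exists>e\<in>D. (s + t) *\<^sub>R e = s *\<^sub>R c + t *\<^sub>R d"
    proof (cases "s + t = 0")
      case True
      then show ?thesis using ij by (auto simp: add_nonneg_eq_0_iff)
    next
      case False
      then have "(s / (s + t)) *\<^sub>R c + (t / (s + t)) *\<^sub>R d \<in> D"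
        using ij by (intro convexD[OF D(1)]) (auto simp: add_divide_distrib[symmetric])
      with False show ?thesis
        by (intro bexI) (auto simp: scaleR_add_right)
    qed
    then obtain e where e: "e \<in> D" "(s + t) *\<^sub>R e = s *\<^sub>R c + t *\<^sub>R d" ..
    have "(x + y) + (s + t) *\<^sub>R e = (x + s *\<^sub>R c) + (y + t *\<^sub>R d)"
      by (simp add: e(2))
    then have "h (s + t, e) (x + y) \<le> h i x + h j y"
      using sublinear_add[OF q, of "x + s *\<^sub>R c" "y + t *\<^sub>R d"]
      by (simp only: h_def ij(1,2) prod.case distrib_right)
    moreover have "(s + t, e) \<in> I"
      using ij e by (simp add: I_def)
    ultimately show "\<exists>k\<in>I. h k (x + y) \<le> h i x + h j y" by blast
  next
    fix i t x assume "i \<in> I" "0 < (t::real)"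
    then obtain s c where i: "i = (s, c)" "0 \<le> s" "c \<in> D"
      by (auto simp: I_def)
    have "h (t * s, c) (t *\<^sub>R x) \<le> t * h i x"
      using sublinear_scaleR_le[OF q \<open>0 < t\<close>, of "x + s *\<^sub>R c"]
      by (simp add: h_def i algebra_simps)
    moreover have "(t * s, c) \<in> I"
      using i \<open>0 < t\<close> by (simp add: I_def)
    ultimately show "\<exists>k\<in>I. h k (t *\<^sub>R x) \<le> t * h i x" by blast
  qed
  moreover have lower: "p x \<le> h i x" if "i \<in> I" for i x
    unfolding p_def using bdd that by (rule cINF_lower)
  have "p x \<le> q x" for x
  proof -
    obtain c where "c \<in> D" using D by auto
    then show ?thesis using lower[of "(0, c)" x] by (simp add: I_def h_def)
  qed
  moreover have "p (- c) \<le> - b" if "c \<in> D" for c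
    using lower[of "(1, c)" "- c"] that sublinear_zero[OF q] by (simp add: I_def h_def)
  ultimately show thesis by (rule that)
qed

text \<open>
  Pushing \<open>q\<close> down at a single point \<open>y\<close>, with the bound \<open>q y\<close>, does not change a minimal \<open>q\<close>.
  So \<open>q (- y) \<le> - q y\<close>, and a sublinear functional that is odd is linear.
\<close>

lemma minimal_sublinear_linear:
  fixes q :: "'a::real_vector \<Rightarrow> real"
  assumes q: "sublinear q"
    and minimal: "\<And>p. sublinear p \<Longrightarrow> (\<And>x. p x \<le> q x) \<Longrightarrow> p = q"
  shows "linear q"
proof -
  have minus: "q (- y) = - q y" for y
  proof -
    obtain p where p: "sublinear p" "\<And>x. p x \<le> q x" "p (- y) \<le> - q y"
      using sublinear_push_down[OF q, of "{y}" "q y"] by auto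
    then have "q (- y) \<le> - q y"
      using minimal by blast
    moreover have "- q y \<le> q (- y)"
      using sublinear_minus[OF q, of "- y"] by simp
    ultimately show ?thesis by simp
  qed
  have "q (x + y) = q x + q y" for x y
    using sublinear_add[OF q, of x y] sublinear_add[OF q, of "- x" "- y"] minus[of "x + y"]
    by (simp add: minus)
  moreover have "q (t *\<^sub>R x) = t *\<^sub>R q x" for t x
  proof (cases t "0::real" rule: linorder_cases)
    case less
    then show ?thesis
      using sublinear_scaleR[OF q, of "- t" x] minus[of "t *\<^sub>R x"] by simp
  qed (use q in \<open>auto simp: sublinear_zero sublinear_scaleR\<close>)
  ultimately show ?thesis by (rule linearI)
qed

text \<open>
  Zorn's lemma gives a minimal sublinear functional below \<open>q\<close>.  A chain has its pointwise infimum
  as a lower bound, which is finite because every sublinear \<open>p \<le> q\<close> satisfies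
  \<open>p x \<ge> - p (- x) \<ge> - q (- x)\<close>.
\<close>

lemma sublinear_dominates_linear:
  fixes q :: "'a::real_vector \<Rightarrow> real"
  assumes q: "sublinear q"
  obtains f where "linear f" "\<And>x. f x \<le> q x"
proof -
  define A where "A = {p. sublinear p \<and> (\<forall>x. p x \<le> q x)}"
  \<comment> \<open>Zorn's lemma speaks of maximal elements, so the pointwise order is reversed.\<close>
  define P where "P = (\<lambda>p r :: 'a \<Rightarrow> real. \<forall>x. r x \<le> p x)"
  have "\<exists>m\<in>A. \<forall>a\<in>A. P m a \<longrightarrow> a = m"
  proof (rule predicate_Zorn)
    show "partial_order_on A (relation_of P A)"
      by (rule partial_order_on_relation_ofI)
        (auto simp: P_def fun_eq_iff intro: order_trans antisym)
  next
    fix K assume "K \<in> Chains (relation_of P A)"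
    then have KA: "K \<subseteq> A" and chain: "\<And>p r. p \<in> K \<Longrightarrow> r \<in> K \<Longrightarrow> P p r \<or> P r p"
      by (auto simp: Chains_def relation_of_def)
    show "\<exists>u\<in>A. \<forall>a\<in>K. P a u"
    proof (cases "K = {}")
      case True
      then show ?thesis using q by (auto simp: A_def)
    next
      case False
      have lin: "sublinear p" if "p \<in> K" for p
        using that KA by (auto simp: A_def)
      have bdd: "bdd_below ((\<lambda>p. p x) ` K)" for x
      proof (rule bdd_belowI2)
        fix p assume "p \<in> K"
        then have "p (- x) \<le> q (- x)" using KA by (auto simp: A_def)
        then show "- q (- x) \<le> p x"
          using sublinear_minus[OF lin[OF \<open>p \<in> K\<close>], of x] by simp
      qed
      define u where "u x = (INF p\<in>K. p x)" for x
      have lower: "u x \<le> p x" if "p \<in> K" for p x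
        unfolding u_def using bdd that by (rule cINF_lower)
      have "sublinear u"
        unfolding u_def
      proof (rule sublinear_INF[OF False bdd])
        fix p r :: "'a \<Rightarrow> real" and x y :: 'a
        assume K: "p \<in> K" "r \<in> K"
        then consider "P p r" | "P r p" using chain by blast
        then show "\<exists>k\<in>K. k (x + y) \<le> p x + r y"
        proof cases
          case 1
          then have "r (x + y) \<le> p x + r y"
            using sublinear_add[OF lin[OF K(2)], of x y] by (simp add: P_def) (smt (verit))
          with K show ?thesis by blast
        next
          case 2
          then have "p (x + y) \<le> p x + r y"
            using sublinear_add[OF lin[OF K(1)], of x y] by (simp add: P_def) (smt (verit))
          with K show ?thesis by blast
        qed
      next
        fix p t and x :: 'a assume "p \<in> K" "0 < (t::real)"
        then show "\<exists>k\<in>K. k (t *\<^sub>R x) \<le> t * p x"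
          using sublinear_scaleR_le[OF lin] by blast
      qed
      moreover have "u x \<le> q x" for x
      proof -
        obtain p where "p \<in> K" using False by auto
        then have "p x \<le> q x" using KA by (auto simp: A_def)
        with lower[OF \<open>p \<in> K\<close>, of x] show ?thesis by simp
      qed
      ultimately have "u \<in> A" by (simp add: A_def)
      then show ?thesis using lower by (auto simp: P_def)
    qed
  qed
  then obtain f where f: "f \<in> A" and min: "\<And>a. a \<in> A \<Longrightarrow> P f a \<Longrightarrow> a = f"
    by blast
  have "linear f"
  proof (rule minimal_sublinear_linear)
    show "sublinear f" using f by (simp add: A_def)
    fix p assume "sublinear p" "\<And>x. p x \<le> f x"
    moreover from this f have "p \<in> A"
      by (auto simp: A_def intro: order_trans)
    ultimately show "p = f"
      by (intro min) (simp_all add: P_def)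
  qed
  with f show thesis by (intro that) (auto simp: A_def)
qed

text \<open>
  The differences \<open>x0 - c\<close> form a convex set on which the norm is at least the distance \<open>d\<close> from
  \<open>x0\<close> to \<open>C\<close>.  A linear functional below the norm pushed down along this set is at least \<open>d\<close> on
  it.
\<close>

lemma separate_point_closed_convex:
  fixes C :: "'a::real_normed_vector set"
  assumes C: "closed C" "convex C" and x0: "x0 \<notin> C"
  obtains u :: "'a \<Rightarrow> real" and d
  where "linear u" "\<And>x. \<bar>u x\<bar> \<le> norm x" "0 < d" "\<And>c. c \<in> C \<Longrightarrow> u c \<le> u x0 - d"
proof (cases "C = {}")
  case True
  show thesis
    by (rule that[of "\<lambda>_. 0" 1]) (auto simp: True linear_zero)
next
  case False
  define D where "D = (\<lambda>c. x0 - c) ` C"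
  have D: "convex D" "D \<noteq> {}"
    using C False convex_linear_image[of uminus C] convex_translation[of "uminus ` C" x0]
    by (auto simp: D_def image_image linear_uminus)
  obtain d where d: "0 < d" "\<And>c. c \<in> C \<Longrightarrow> d \<le> dist x0 c"
    using C(1) x0 unfolding closed_def open_contains_ball by (force simp: not_less)
  have "d \<le> norm c" if "c \<in> D" for c
    using that d(2) by (auto simp: D_def dist_norm)
  then obtain p where p: "sublinear p" "\<And>x. p x \<le> norm x" "\<And>c. c \<in> D \<Longrightarrow> p (- c) \<le> - d"
    using sublinear_push_down[OF sublinear_norm D] by blast
  obtain u where u: "linear u" "\<And>x. u x \<le> p x"
    using sublinear_dominates_linear[OF p(1)] by blast
  show thesis
  proof (rule that[OF u(1) _ d(1)])
    fix x
    have "u x \<le> norm x" "u (- x) \<le> norm (- x)"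
      using u(2) p(2) order_trans by blast+
    then show "\<bar>u x\<bar> \<le> norm x"
      by (simp add: linear_neg[OF u(1)])
  next
    fix c assume "c \<in> C"
    then have "u (- (x0 - c)) \<le> - d"
      using u(2)[of "- (x0 - c)"] p(3)[of "x0 - c"] by (auto simp: D_def)
    then show "u c \<le> u x0 - d"
      by (simp add: linear_diff[OF u(1)])
  qed
qed

section \<open>Functionals with a prescribed real part\<close>

lemma to_complex_of_real: "to_complex (of_real r :: 'k::real_or_complex) = of_real r"
proof -
  have "to_complex (1::'k) * to_complex (1::'k) = to_complex (1::'k)"
    by (simp flip: to_complex_mult)
  moreover have "to_complex (1::'k) \<noteq> 0"
    using norm_to_complex[of "1::'k"] by auto
  ultimately have "to_complex (1::'k) = 1" by simp
  then show ?thesis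
    using to_complex_scaleR[of r "1::'k"] by (simp add: of_real_def)
qed

lemma to_complex_inject:
  fixes x y :: "'k::real_or_complex"
  assumes "to_complex x = to_complex y"
  shows "x = y"
proof -
  have "to_complex (x - y) + to_complex y = to_complex x"
    by (simp flip: to_complex_add)
  then have "cmod (to_complex (x - y)) = 0"
    using assms by simp
  then show ?thesis
    unfolding norm_to_complex by simp
qed

lemma to_complex_uminus: "to_complex (- x) = - to_complex x"
  using to_complex_scaleR[of "-1" x] by simp

text \<open>
  For complex scalars this is the formula \<open>f x = u x - i u (i x)\<close>.  With \<open>i = 0\<close> it also
  covers real scalars, so the two cases differ only in the choice of \<open>i\<close>.  The crude
  bound \<open>2\<close> for the norm of \<open>f\<close> suffices for continuity.
\<close>

lemma linear_functional_with_real_part: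
  fixes smul :: "'k::real_or_complex \<Rightarrow> 'a::real_normed_vector \<Rightarrow> 'a"
  assumes X: "normed_space_over smul" and u: "linear u" and bound: "\<And>x. \<bar>u x\<bar> \<le> norm x"
  obtains f :: "'a \<Rightarrow>\<^sub>L 'k" where "f \<in> dual_space smul" "\<And>x. re_part (f x) = u x"
proof -
  interpret X: normed_space_over smul by fact
  have real: "smul (of_real r) x = r *\<^sub>R x" for r x
    by (rule X.smul_of_real)
  obtain i :: 'k where span: "\<And>c. \<exists>a b. c = of_real a + i * of_real b"
    and i: "i = 0 \<or> i * i = - 1" and Re_i: "Re (to_complex i) = 0" and norm_i: "norm i \<le> 1"
  proof (cases "range (to_complex :: 'k \<Rightarrow> complex) = \<real>")
    case True
    show thesis
    proof (rule that[of 0])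
      fix c :: 'k
      have "to_complex c \<in> \<real>" using True by auto
      then obtain a where "to_complex c = of_real a" by (auto elim: Reals_cases)
      then have "c = of_real a"
        by - (rule to_complex_inject, simp add: to_complex_of_real)
      then show "\<exists>a b. c = of_real a + 0 * of_real b" by auto
    qed (use to_complex_of_real[of 0, where 'k = 'k] in auto)
  next
    case False
    then have "range (to_complex :: 'k \<Rightarrow> complex) = UNIV"
      using range_to_complex by blast
    then obtain i :: 'k where i: "to_complex i = \<i>" by (metis rangeE UNIV_I)
    show thesis
    proof (rule that[of i])
      fix c :: 'k
      have "c = of_real (Re (to_complex c)) + i * of_real (Im (to_complex c))"
        by (rule to_complex_inject)
          (simp add: to_complex_add to_complex_mult to_complex_of_real i complex_eq)
      then show "\<exists>a b. c = of_real a + i * of_real b" by blast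
    next
      have "i * i = - 1"
        using to_complex_of_real[of 1, where 'k = 'k]
        by - (rule to_complex_inject, simp add: to_complex_mult to_complex_uminus i)
      then show "i = 0 \<or> i * i = - 1" ..
    qed (use i norm_to_complex[of i] in auto)
  qed
  define f where "f x = of_real (u x) - i * of_real (u (smul i x))" for x
  have f_add: "f (x + y) = f x + f y" for x y
    by (simp add: f_def linear_add[OF u] X.scale_right_distrib algebra_simps)
  have f_real: "f (smul (of_real r) x) = of_real r * f x" for r x
  proof -
    have "smul i (r *\<^sub>R x) = r *\<^sub>R smul i x"
      unfolding real[symmetric] by (simp add: mult.commute)
    then show ?thesis
      by (simp add: f_def real linear_scale[OF u] algebra_simps)
  qed
  have f_i: "f (smul i x) = i * f x" for x
  proof (cases "i = 0")
    case True
    then show ?thesis by (simp add: f_def linear_0[OF u])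
  next
    case False
    with i have ii: "i * i = - 1" by simp
    then have "smul i (smul i x) = - x"
      by simp
    then show ?thesis
      using ii by (simp add: f_def linear_neg[OF u] algebra_simps mult.assoc[symmetric])
  qed
  have f_scale: "f (smul c x) = c * f x" for c x
  proof -
    obtain a b where "c = of_real a + i * of_real b"
      using span by blast
    then show ?thesis
      by (simp add: X.scale_left_distrib f_add f_real f_i distrib_right mult.assoc
          flip: X.scale_scale)
  qed
  have f_bound: "norm (f x) \<le> norm x * 2" for x
  proof -
    have "norm (f x) \<le> \<bar>u x\<bar> + norm i * \<bar>u (smul i x)\<bar>"
      unfolding f_def by (rule order_trans[OF norm_triangle_ineq4]) (simp add: norm_mult)
    also have "\<dots> \<le> norm x + 1 * norm (smul i x)"
      using bound norm_i by (intro add_mono mult_mono) auto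
    also have "\<dots> \<le> norm x * 2"
      using norm_i by (simp add: X.norm_smul mult_left_le_one_le)
    finally show ?thesis .
  qed
  have "f (r *\<^sub>R x) = r *\<^sub>R f x" for r x
    using f_real[of r x] by (simp add: real scaleR_conv_of_real)
  then have "bounded_linear f"
    using f_add f_bound by (intro bounded_linear_intro)
  then have apply_f: "blinfun_apply (Blinfun f) = f"
    by (rule bounded_linear_Blinfun_apply)
  have "vector_space ((*) :: 'k \<Rightarrow> 'k \<Rightarrow> 'k)"
    by unfold_locales (auto simp: algebra_simps)
  then have "Blinfun f \<in> dual_space smul"
    by (auto simp: dual_space_def apply_f Vector_Spaces.linear_iff f_add f_scale X.vector_space_axioms)
  moreover have "re_part (Blinfun f x) = u x" for x
  proof -
    have "to_complex (f x) + to_complex (i * of_real (u (smul i x))) = of_real (u x)"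
      by (simp add: f_def to_complex_of_real flip: to_complex_add)
    then have "Re (to_complex (f x)) + Re (to_complex i * of_real (u (smul i x))) = u x"
      by (metis to_complex_mult to_complex_of_real plus_complex.sel(1) Re_complex_of_real)
    then show ?thesis
      by (simp add: re_part_def apply_f Re_i)
  qed
  ultimately show thesis by (rule that)
qed

section \<open>Averaging over a compact group\<close>

lemma convex_bounded_linear_vimage:
  assumes "bounded_linear L" "convex S"
  shows "convex {T. L T \<in> S}"
  using convex_linear_vimage[OF bounded_linear.linear[OF assms(1)] assms(2)]
  by (simp add: vimage_def)

lemma norm_comp_le:
  shows "norm A \<le> a \<Longrightarrow> norm B \<le> b \<Longrightarrow> norm (A o\<^sub>L B) \<le> a * b"
  by (rule order_trans[OF norm_blinfun_compose]) (auto intro!: mult_mono order_trans[OF norm_ge_zero])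

locale compact_isometry_group =
  fixes G :: "('a::banach \<Rightarrow>\<^sub>L 'a) set"
  assumes compact: "compact G"
    and id_mem: "id_blinfun \<in> G"
    and comp_mem: "g \<in> G \<Longrightarrow> h \<in> G \<Longrightarrow> g o\<^sub>L h \<in> G"
    and inverse_ex: "g \<in> G \<Longrightarrow> \<exists>h\<in>G. h o\<^sub>L g = id_blinfun"
    and isometry: "g \<in> G \<Longrightarrow> norm (blinfun_apply g x) = norm x"
begin

lemma hull_comp:
  assumes A: "A \<in> convex hull G" and B: "B \<in> convex hull G"
  shows "A o\<^sub>L B \<in> convex hull G"
proof -
  have "convex hull G \<subseteq> {B. g o\<^sub>L B \<in> convex hull G}" if "g \<in> G" for g
    using that comp_mem
    by (intro hull_minimal convex_bounded_linear_vimage convex_convex_hull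
        bounded_bilinear.bounded_linear_right[OF bounded_bilinear_blinfun_compose])
      (auto intro: hull_inc)
  then have "convex hull G \<subseteq> {A. A o\<^sub>L B \<in> convex hull G}"
    using B
    by (intro hull_minimal convex_bounded_linear_vimage convex_convex_hull
        bounded_bilinear.bounded_linear_left[OF bounded_bilinear_blinfun_compose]) auto
  with A show ?thesis by auto
qed

lemma norm_hull_le:
  assumes "A \<in> convex hull G"
  shows "norm A \<le> 1"
proof -
  have "convex hull G \<subseteq> cball 0 1"
    using isometry by (intro hull_minimal) (auto intro!: norm_blinfun_bound)
  with assms show ?thesis by auto
qed

definition orbit_diameter_le :: "('a \<Rightarrow>\<^sub>L 'a) \<Rightarrow> real \<Rightarrow> bool"
  where "orbit_diameter_le A e \<longleftrightarrow> (\<forall>g\<in>G. \<forall>h\<in>G. norm ((A o\<^sub>L g) - (A o\<^sub>L h)) \<le> e)"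

lemma orbit_diameter_comp:
  assumes A: "A \<in> convex hull G" and B: "orbit_diameter_le B e"
  shows "orbit_diameter_le (A o\<^sub>L B) e"
  unfolding orbit_diameter_le_def
proof (intro ballI)
  fix g h assume "g \<in> G" "h \<in> G"
  then have "norm ((B o\<^sub>L g) - (B o\<^sub>L h)) \<le> e"
    using B by (auto simp: orbit_diameter_le_def)
  then have "norm (A o\<^sub>L ((B o\<^sub>L g) - (B o\<^sub>L h))) \<le> 1 * e"
    by (rule norm_comp_le[OF norm_hull_le[OF A]])
  moreover have "A o\<^sub>L ((B o\<^sub>L g) - (B o\<^sub>L h)) = ((A o\<^sub>L B) o\<^sub>L g) - ((A o\<^sub>L B) o\<^sub>L h)"
    by (rule blinfun_eqI) (simp add: blinfun.bilinear_simps)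
  ultimately show "norm (((A o\<^sub>L B) o\<^sub>L g) - ((A o\<^sub>L B) o\<^sub>L h)) \<le> e"
    by simp
qed

text \<open>
  The operators \<open>B\<close> with this property form a convex set, and it contains \<open>G\<close> because \<open>A\<close> itself
  lies on the orbit of \<open>A\<close>.
\<close>

lemma hull_moves_little:
  assumes A: "orbit_diameter_le A e" and B: "B \<in> convex hull G"
  shows "norm ((A o\<^sub>L B) - A) \<le> e"
proof -
  have "convex hull G \<subseteq> {B. A o\<^sub>L B \<in> cball A e}"
  proof (intro hull_minimal convex_bounded_linear_vimage
      bounded_bilinear.bounded_linear_right[OF bounded_bilinear_blinfun_compose])
    have "A o\<^sub>L id_blinfun = A"
      by (rule blinfun_eqI) simp
    then show "G \<subseteq> {B. A o\<^sub>L B \<in> cball A e}"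
      using A id_mem by (force simp: orbit_diameter_le_def dist_norm)
  qed auto
  with B show ?thesis by (auto simp: dist_norm norm_minus_commute)
qed

text \<open>
  The difference of two points \<open>A \<circ> M \<circ> h\<close> and \<open>A \<circ> M \<circ> k\<close> of the new orbit is the mean of the
  \<open>n\<^sup>2\<close> differences \<open>A \<circ> f \<circ> h - A \<circ> f' \<circ> k\<close> with \<open>f, f' \<in> F\<close>.  Each has norm at most \<open>e\<close>,
  and at least one has norm at most \<open>\<delta>\<close>: for any \<open>f\<close>, choose \<open>f'\<close> in the net close to
  \<open>f \<circ> h \<circ> k\<^sup>-\<^sup>1\<close> and use that \<open>k\<close> is an isometry.
\<close>

lemma average_over_net:
  assumes F: "finite F" "F \<noteq> {}" "F \<subseteq> G" and net: "\<And>g. g \<in> G \<Longrightarrow> \<exists>f\<in>F. norm (g - f) \<le> \<delta>"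
    and A: "A \<in> convex hull G" "orbit_diameter_le A e"
  defines "n \<equiv> real (card F)" and "M \<equiv> (\<Sum>f\<in>F. (1 / real (card F)) *\<^sub>R f)"
  shows "orbit_diameter_le (A o\<^sub>L M) (((n\<^sup>2 - 1) * e + \<delta>) / n\<^sup>2)"
  unfolding orbit_diameter_le_def
proof (intro ballI)
  fix h k assume hk: "h \<in> G" "k \<in> G"
  have n: "n > 0" using F by (simp add: n_def card_gt_0_iff)
  have M_comp: "((A o\<^sub>L M) o\<^sub>L g) = (\<Sum>f\<in>F. (1 / n) *\<^sub>R (A o\<^sub>L (f o\<^sub>L g)))" for g
    by (rule blinfun_eqI) (simp add: M_def n_def blinfun.bilinear_simps blinfun.sum_left blinfun.sum_right)
  define D where "D = (\<lambda>(f, f'). (A o\<^sub>L (f o\<^sub>L h)) - (A o\<^sub>L (f' o\<^sub>L k)))"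
  have "(\<Sum>i\<in>F \<times> F. D i) = n *\<^sub>R (\<Sum>f\<in>F. A o\<^sub>L (f o\<^sub>L h)) - n *\<^sub>R (\<Sum>f\<in>F. A o\<^sub>L (f o\<^sub>L k))"
    by (simp add: D_def n_def sum_subtractf scaleR_sum_right sum_constant_scaleR
        flip: sum.cartesian_product)
  then have diff: "((A o\<^sub>L M) o\<^sub>L h) - ((A o\<^sub>L M) o\<^sub>L k) = (1 / n\<^sup>2) *\<^sub>R (\<Sum>i\<in>F \<times> F. D i)"
    using n by (simp add: M_comp scaleR_sum_right[symmetric] power2_eq_square scaleR_diff_right)
  obtain f where f: "f \<in> F" using F by auto
  obtain k' where k': "k' \<in> G" "k' o\<^sub>L k = id_blinfun"
    using inverse_ex[OF hk(2)] by blast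
  obtain f' where f': "f' \<in> F" "norm ((f o\<^sub>L (h o\<^sub>L k')) - f') \<le> \<delta>"
    using net comp_mem hk k' f F by (meson subsetD)
  have "norm (D i) \<le> e" if "i \<in> F \<times> F" for i
  proof -
    obtain f f' where "i = (f, f')" "f o\<^sub>L h \<in> G" "f' o\<^sub>L k \<in> G"
      using \<open>i \<in> F \<times> F\<close> F(3) hk comp_mem by blast
    then show ?thesis
      using A(2) by (simp add: D_def orbit_diameter_le_def)
  qed
  moreover have "norm (D (f, f')) \<le> \<delta>"
  proof -
    have "k' (k x) = x" for x
      using arg_cong[OF k'(2), of "\<lambda>T. blinfun_apply T x"] by simp
    then have "D (f, f') = A o\<^sub>L (((f o\<^sub>L (h o\<^sub>L k')) - f') o\<^sub>L k)"
      by (intro blinfun_eqI) (simp add: D_def blinfun.bilinear_simps)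
    moreover have "norm (A o\<^sub>L (((f o\<^sub>L (h o\<^sub>L k')) - f') o\<^sub>L k)) \<le> 1 * (\<delta> * 1)"
      using A f' hk by (intro norm_comp_le norm_hull_le) (auto intro: hull_inc)
    ultimately show ?thesis by simp
  qed
  ultimately have "norm (D (f, f') + (\<Sum>i\<in>F \<times> F - {(f, f')}. D i))
      \<le> \<delta> + (\<Sum>i\<in>F \<times> F - {(f, f')}. e)"
    by (intro norm_triangle_mono sum_norm_le) auto
  then have "norm (\<Sum>i\<in>F \<times> F. D i) \<le> \<delta> + (\<Sum>i\<in>F \<times> F - {(f, f')}. e)"
    using f f' F(1) sum.remove[of "F \<times> F" "(f, f')" D] by simp
  also have "(\<Sum>i\<in>F \<times> F - {(f, f')}. e) = (n\<^sup>2 - 1) * e"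
  proof -
    have "1 \<le> card F * card F"
      using F by (simp add: Suc_le_eq card_gt_0_iff)
    then show ?thesis
      using f f' F(1)
      by (simp add: card_Diff_singleton card_cartesian_product n_def of_nat_diff power2_eq_square)
  qed
  finally show "norm (((A o\<^sub>L M) o\<^sub>L h) - ((A o\<^sub>L M) o\<^sub>L k)) \<le> ((n\<^sup>2 - 1) * e + \<delta>) / n\<^sup>2"
    using n by (simp add: diff divide_right_mono add.commute)
qed

text \<open>
  Suppose the infimum \<open>\<rho>\<close> of all orbit diameters were positive.  The net is fixed first, of mesh
  \<open>\<rho> / 2\<close>; its size \<open>n\<close> does not depend on \<open>A\<close>.  One averaging step then takes any \<open>A\<close> whose
  orbit diameter is close enough to \<open>\<rho>\<close> strictly below \<open>\<rho>\<close>.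
\<close>

lemma small_orbit_diameter_ex:
  assumes "0 < \<epsilon>"
  obtains A where "A \<in> convex hull G" "orbit_diameter_le A \<epsilon>"
proof -
  define E where "E = {e. \<exists>A\<in>convex hull G. orbit_diameter_le A e}"
  have id: "id_blinfun \<in> convex hull G"
    using id_mem by (rule hull_inc)
  have "orbit_diameter_le id_blinfun 2"
    unfolding orbit_diameter_le_def
  proof (intro ballI)
    fix g h assume gh: "g \<in> G" "h \<in> G"
    have "norm (id_blinfun o\<^sub>L g) \<le> 1" "norm (id_blinfun o\<^sub>L h) \<le> 1"
      using gh id_mem by (auto intro!: norm_hull_le hull_inc comp_mem)
    then show "norm ((id_blinfun o\<^sub>L g) - (id_blinfun o\<^sub>L h)) \<le> 2"
      using norm_triangle_ineq4[of "id_blinfun o\<^sub>L g" "id_blinfun o\<^sub>L h"] by linarith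
  qed
  then have ne: "E \<noteq> {}" using id by (auto simp: E_def)
  have E_nonneg: "0 \<le> e" if "e \<in> E" for e
    using that id_mem unfolding E_def orbit_diameter_le_def by (auto intro: order_trans[OF norm_ge_zero])
  define \<rho> where "\<rho> = Inf E"
  have \<rho>_le: "\<rho> \<le> e" if "e \<in> E" for e
    unfolding \<rho>_def using that E_nonneg by (intro cInf_lower bdd_belowI)
  have "\<rho> \<le> 0"
  proof (rule ccontr)
    assume "\<not> \<rho> \<le> 0"
    then have \<rho>: "0 < \<rho>" by simp
    obtain F where F: "F \<subseteq> G" "finite F" "G \<subseteq> (\<Union>f\<in>F. ball f (\<rho> / 2))"
      using compactE_image[OF compact, of G "\<lambda>f. ball f (\<rho> / 2)"] \<rho> by force
    have net: "\<exists>f\<in>F. norm (g - f) \<le> \<rho> / 2" if "g \<in> G" for g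
      using F(3) that by (force simp: dist_norm norm_minus_commute)
    have Fne: "F \<noteq> {}" using F(3) id_mem by auto
    define n where "n = real (card F)"
    have n: "1 \<le> n\<^sup>2"
      using Fne F by (simp add: n_def Suc_le_eq card_gt_0_iff)
    \<comment> \<open>The step gains about \<open>\<rho> / (2 * n\<^sup>2)\<close>, so an excess of half of this over the infimum is affordable.\<close>
    have "\<rho> < \<rho> + \<rho> / (4 * n\<^sup>2)"
      using \<rho> n by (simp add: zero_less_divide_iff) auto
    then obtain e where e: "e \<in> E" "e < \<rho> + \<rho> / (4 * n\<^sup>2)"
      using cInf_lessD[OF ne] unfolding \<rho>_def by blast
    then obtain A where A: "A \<in> convex hull G" "orbit_diameter_le A e"
      by (auto simp: E_def)
    have "(\<Sum>f\<in>F. (1 / real (card F)) *\<^sub>R f) \<in> convex hull G"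
      using F Fne by (intro convex_sum) (auto intro: hull_inc)
    then have "((n\<^sup>2 - 1) * e + \<rho> / 2) / n\<^sup>2 \<in> E"
      using average_over_net[OF F(2) Fne F(1) net A] hull_comp[OF A(1)]
      unfolding E_def n_def by blast
    then have "\<rho> \<le> ((n\<^sup>2 - 1) * e + \<rho> / 2) / n\<^sup>2"
      by (rule \<rho>_le)
    then have "\<rho> * n\<^sup>2 \<le> (n\<^sup>2 - 1) * e + \<rho> / 2"
      using n by (subst (asm) pos_le_divide_eq) auto
    also have "(n\<^sup>2 - 1) * e \<le> (n\<^sup>2 - 1) * (\<rho> + \<rho> / (4 * n\<^sup>2))"
      using e n by (intro mult_left_mono) auto
    also have "\<dots> + \<rho> / 2 = \<rho> * n\<^sup>2 - \<rho> / 4 - \<rho> / (4 * n\<^sup>2)"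
    proof -
      have "n \<noteq> 0" using n by auto
      then show ?thesis by (simp add: field_simps)
    qed
    finally show False
      using \<rho> n by (smt (verit) divide_pos_pos mult_pos_pos)
  qed
  then obtain e where e: "e \<in> E" "e < \<epsilon>"
    using cInf_lessD[OF ne, of \<epsilon>] assms unfolding \<rho>_def by auto
  then show thesis
    using that unfolding E_def orbit_diameter_le_def by (smt (verit) mem_Collect_eq)
qed

text \<open>
  The approximations \<open>B\<^sub>m\<close> of orbit diameter at most \<open>1 / (m + 1)\<close> need not converge, but their
  products \<open>A\<^sub>m = B\<^sub>0 \<circ> \<dots> \<circ> B\<^sub>m\<close> do: composing on the left with an operator of norm at most \<open>1\<close>
  does not increase the orbit diameter of \<open>B\<^sub>m\<close>, and all later products are \<open>A\<^sub>m \<circ> T\<close> with \<open>T\<close> in the hull, hence close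
  to \<open>A\<^sub>m\<close>.
\<close>

lemma invariant_average_ex:
  obtains P where "P \<in> closure (convex hull G)" "\<And>g. g \<in> G \<Longrightarrow> P o\<^sub>L g = P"
proof -
  have "\<exists>B. B \<in> convex hull G \<and> orbit_diameter_le B (1 / Suc m)" for m
    using small_orbit_diameter_ex[of "1 / Suc m"] by auto
  then obtain B where B: "\<And>m. B m \<in> convex hull G" "\<And>m. orbit_diameter_le (B m) (1 / Suc m)"
    by metis
  define A where "A = rec_nat (B 0) (\<lambda>m T. T o\<^sub>L B (Suc m))"
  have A_simps: "A 0 = B 0" "\<And>m. A (Suc m) = A m o\<^sub>L B (Suc m)"
    by (simp_all add: A_def)
  have A_hull: "A m \<in> convex hull G" for m
    by (induction m) (auto simp: A_simps B intro: hull_comp)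
  have A_diam: "orbit_diameter_le (A m) (1 / Suc m)" for m
    using B(2) orbit_diameter_comp[OF A_hull] by (cases m) (simp_all only: A_simps)
  have tail: "\<exists>T\<in>convex hull G. A (m + j) = A m o\<^sub>L T" for m j
  proof (induction j)
    case 0
    show ?case
      using id_mem by (intro bexI[of _ id_blinfun]) (auto intro: hull_inc blinfun_eqI)
  next
    case (Suc j)
    then obtain T where T: "T \<in> convex hull G" "A (m + j) = A m o\<^sub>L T" by blast
    have "A (m + Suc j) = A m o\<^sub>L (T o\<^sub>L B (Suc (m + j)))"
      by (rule blinfun_eqI) (simp add: A_simps T)
    then show ?case
      using hull_comp[OF T(1) B(1)] by blast
  qed
  have close: "norm (A k - A m) \<le> 1 / Suc m" if "m \<le> k" for m k
  proof -
    obtain T where "T \<in> convex hull G" "A (m + (k - m)) = A m o\<^sub>L T"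
      using tail by blast
    then show ?thesis
      using hull_moves_little[OF A_diam] that by simp
  qed
  have "Cauchy A"
  proof (rule CauchyI')
    fix e :: real assume "0 < e"
    then obtain N where N: "1 / Suc N < e"
      by (metis nat_approx_posE)
    show "\<exists>M. \<forall>m\<ge>M. \<forall>n>m. dist (A m) (A n) < e"
    proof (intro exI allI impI)
      fix m n assume "N \<le> m" "m < n"
      then have "norm (A n - A m) \<le> 1 / Suc m"
        by (intro close) simp
      also have "\<dots> \<le> 1 / Suc N"
        using \<open>N \<le> m\<close> by (simp add: frac_le)
      finally show "dist (A m) (A n) < e"
        using N by (simp add: dist_norm norm_minus_commute)
    qed
  qed
  then obtain P where P: "A \<longlonglongrightarrow> P"
    using Cauchy_convergent_iff convergent_def by blast
  show thesis
  proof (rule that)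
    show "P \<in> closure (convex hull G)"
      using P A_hull closure_sequential by blast
    fix g assume g: "g \<in> G"
    have "(\<lambda>m. (A m o\<^sub>L g) - A m) \<longlonglongrightarrow> (P o\<^sub>L g) - P"
      by (intro tendsto_diff P bounded_bilinear.tendsto[OF bounded_bilinear_blinfun_compose]
          tendsto_const)
    moreover have "(\<lambda>m. (A m o\<^sub>L g) - A m) \<longlonglongrightarrow> 0"
    proof (rule Lim_null_comparison)
      show "\<forall>\<^sub>F m in sequentially. norm ((A m o\<^sub>L g) - A m) \<le> inverse (Suc m)"
        using hull_moves_little[OF A_diam hull_inc[OF g]] by (simp add: inverse_eq_divide)
      show "(\<lambda>m. inverse (real (Suc m))) \<longlonglongrightarrow> 0"
        by (rule LIMSEQ_inverse_real_of_nat)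
    qed
    ultimately have "(P o\<^sub>L g) - P = 0"
      by (rule LIMSEQ_unique)
    then show "P o\<^sub>L g = P" by simp
  qed
qed

end

section \<open>Invariant separation\<close>

lemma closure_hull_maps_into:
  fixes G :: "('a::real_normed_vector \<Rightarrow>\<^sub>L 'b::real_normed_vector) set"
  assumes P: "P \<in> closure (convex hull G)" and S: "closed S" "convex S"
    and G: "\<And>g. g \<in> G \<Longrightarrow> blinfun_apply g x \<in> S"
  shows "blinfun_apply P x \<in> S"
proof -
  have bl: "bounded_linear (\<lambda>T. blinfun_apply T x)"
    by (rule bounded_bilinear.bounded_linear_left[OF bounded_bilinear_blinfun_apply])
  have "closed {T. blinfun_apply T x \<in> S}"
    using continuous_closed_vimage[OF S(1), of "\<lambda>T. blinfun_apply T x"]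
    by (simp add: vimage_def linear_continuous_at[OF bl])
  then have "closure (convex hull G) \<subseteq> {T. blinfun_apply T x \<in> S}"
    using G by (intro closure_minimal hull_minimal convex_bounded_linear_vimage[OF bl S(2)]) auto
  with P show ?thesis by auto
qed

text \<open>
  The instance needed is the multiplication \<open>L\<close> by a fixed scalar, which is not
  covered by the real-linearity of bounded operators.
\<close>

lemma closure_hull_commutes:
  fixes G :: "('a::real_normed_vector \<Rightarrow>\<^sub>L 'a) set"
  assumes P: "P \<in> closure (convex hull G)" and L: "bounded_linear L"
    and G: "\<And>g. g \<in> G \<Longrightarrow> blinfun_apply g (L x) = L (blinfun_apply g x)"
  shows "blinfun_apply P (L x) = L (blinfun_apply P x)"
proof -
  have bl: "bounded_linear (\<lambda>T. blinfun_apply T (L x) - L (blinfun_apply T x))"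
    by (intro bounded_linear_sub bounded_linear_compose[OF L]
        bounded_bilinear.bounded_linear_left[OF bounded_bilinear_blinfun_apply])
  have "closed {T. blinfun_apply T (L x) - L (blinfun_apply T x) \<in> {0}}"
    using continuous_closed_vimage[of "{0}" "\<lambda>T. blinfun_apply T (L x) - L (blinfun_apply T x)"]
    by (simp add: vimage_def linear_continuous_at[OF bl])
  then have "closure (convex hull G) \<subseteq> {T. blinfun_apply T (L x) - L (blinfun_apply T x) \<in> {0}}"
    using G by (intro closure_minimal hull_minimal convex_bounded_linear_vimage[OF bl]) auto
  with P show ?thesis by auto
qed

theorem theorem3p1:
  fixes smul :: "'k::real_or_complex \<Rightarrow> 'a::banach \<Rightarrow> 'a"
    and G :: "('a \<Rightarrow>\<^sub>L 'a) set"
    and C :: "'a set"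
    and x0 :: 'a
  assumes "normed_space_over smul"
    and "group_of_isometries smul G"
    and "compact G"
    and "closed C"
    and "convex C"
    and "invariant_set G C"
    and "invariant_point G x0"
    and "x0 \<notin> C"
  shows "\<exists>f \<in> dual_space smul. invariant_functional G f \<and>
    ereal (re_part (blinfun_apply f x0)) > (SUP x\<in>C. ereal (re_part (blinfun_apply f x)))"
proof -
  interpret X: normed_space_over smul by fact
  interpret compact_isometry_group G
    using assms(2,3)
    by unfold_locales (auto simp: group_of_isometries_def operator_group_def)
  obtain P where P: "P \<in> closure (convex hull G)" "\<And>g. g \<in> G \<Longrightarrow> P o\<^sub>L g = P"
    using invariant_average_ex by blast
  have P_x0: "P x0 = x0"
    using closure_hull_maps_into[OF P(1), of "{x0}" x0] assms(7)
    by (auto simp: invariant_point_def)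
  have P_C: "P x \<in> C" if "x \<in> C" for x
    using closure_hull_maps_into[OF P(1) assms(4,5)] assms(6) that
    by (auto simp: invariant_set_def)
  have P_smul: "P (smul c x) = smul c (P x)" for c x
  proof (rule closure_hull_commutes[OF P(1)])
    have "smul c (r *\<^sub>R x) = r *\<^sub>R smul c x" for r x
      unfolding X.smul_of_real[symmetric] by (simp add: mult.commute)
    then show "bounded_linear (smul c)"
      by (intro bounded_linear_intro[of _ "norm c"])
        (simp_all add: X.scale_right_distrib X.norm_smul mult.commute)
    fix g assume "g \<in> G"
    then show "blinfun_apply g (smul c x) = smul c (blinfun_apply g x)"
      using assms(2)
      by (auto simp: group_of_isometries_def operator_group_def bounded_operators_def
          Vector_Spaces.linear_iff)
  qed
  obtain u d where u: "linear u" "\<And>x. \<bar>u x\<bar> \<le> norm x" "0 < d"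
    "\<And>c. c \<in> C \<Longrightarrow> u c \<le> u x0 - d"
    using separate_point_closed_convex[OF assms(4,5,8)] by blast
  obtain f :: "'a \<Rightarrow>\<^sub>L 'k" where f: "f \<in> dual_space smul" "\<And>x. re_part (f x) = u x"
    using linear_functional_with_real_part[OF assms(1) u(1,2)] by blast
  show ?thesis
  proof (intro bexI[of _ "f o\<^sub>L P"] conjI)
    show "f o\<^sub>L P \<in> dual_space smul"
      using f(1) by (simp add: dual_space_def Vector_Spaces.linear_iff blinfun.add_right P_smul)
    have "P (g x) = P x" if "g \<in> G" for g x
      using arg_cong[OF P(2)[OF that], of "\<lambda>T. blinfun_apply T x"] by simp
    then show "invariant_functional G (f o\<^sub>L P)"
      by (simp add: invariant_functional_def)
    have "(SUP x\<in>C. ereal (re_part ((f o\<^sub>L P) x))) \<le> ereal (u x0 - d)"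
      using u(4) P_C by (intro SUP_least) (simp add: f)
    also have "\<dots> < ereal (re_part ((f o\<^sub>L P) x0))"
      using u(3) by (simp add: f P_x0)
    finally show "(SUP x\<in>C. ereal (re_part ((f o\<^sub>L P) x))) < ereal (re_part ((f o\<^sub>L P) x0))" .
  qed
qed

end
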